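(* Let $D$ be an integral domain with quotient field $K$ and let $E$ be a nonempty subset of $K$. The integral domain $\mathrm{Int}^{\mathrm R}(E,D)$ is seminormal if and only if $D$ is seminormal.
   Context: $\mathrm{Int}^{\mathrm R}(E,D):=\{f\in K(X);\ f(E)\subseteq D\}$, where $f(E)\subseteq D$ means that for every $e\in E$ the rational function $f$ is defined at $e$ and $f(e)\in D$. An integral domain $R$ with quotient field $F$ is seminormal if, for each $\alpha\in F$, whenever $\alpha^2,\alpha^3\in R$, then $\alpha\in R$. *)

theory Defs
  imports
    "HOL-Computational_Algebra.Polynomial"
    "HOL-Computational_Algebra.Fraction_Field"
begin

text \<open>
  Integral domains are represented as unital subrings of an ambient field, so that an integral
  domain and its quotient field live in one type. The field \<open>K(X)\<close> of rational functions over a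
  field \<open>K\<close> (a type \<open>'k\<close>) is \<open>'k poly fract\<close>.
\<close>

definition unital_subring :: "'f::field set \<Rightarrow> bool" where
  "unital_subring R \<longleftrightarrow> 1 \<in> R \<and> (\<forall>a\<in>R. \<forall>b\<in>R. a - b \<in> R \<and> a * b \<in> R)"

definition quotient_field :: "'f::field set \<Rightarrow> 'f set" where
  "quotient_field R = {a / b | a b. a \<in> R \<and> b \<in> R \<and> b \<noteq> 0}"

definition seminormal :: "'f::field set \<Rightarrow> bool" where
  "seminormal R \<longleftrightarrow> (\<forall>\<alpha>\<in>quotient_field R. \<alpha> ^ 2 \<in> R \<and> \<alpha> ^ 3 \<in> R \<longrightarrow> \<alpha> \<in> R)"

text \<open>
  A rational function is defined at \<open>e\<close> if some representation \<open>p / q\<close> of it has \<open>q(e) \<noteq> 0\<close>;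
  other representations of the same function may have a common zero at \<open>e\<close>.
\<close>

definition ratfun_defined_at :: "'k::field poly fract \<Rightarrow> 'k \<Rightarrow> bool" where
  "ratfun_defined_at f e \<longleftrightarrow> (\<exists>p q. f = Fract p q \<and> poly q e \<noteq> 0)"

definition ratfun_eval :: "'k::field poly fract \<Rightarrow> 'k \<Rightarrow> 'k" where
  "ratfun_eval f e = (THE v. \<exists>p q. f = Fract p q \<and> poly q e \<noteq> 0 \<and> v = poly p e / poly q e)"

definition IntR :: "'k::field set \<Rightarrow> 'k set \<Rightarrow> 'k poly fract set" where
  "IntR E D = {f. \<forall>e\<in>E. ratfun_defined_at f e \<and> ratfun_eval f e \<in> D}"

text \<open>The value does not depend on the representation.\<close>

lemma ratfun_eval_Fract:
  assumes "poly q e \<noteq> 0"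
  shows "ratfun_eval (Fract p q) e = poly p e / poly q e"
  unfolding ratfun_eval_def
proof (rule the_equality)
  show "\<exists>p' q'. Fract p q = Fract p' q' \<and> poly q' e \<noteq> 0 \<and>
          poly p e / poly q e = poly p' e / poly q' e"
    using assms by blast
next
  fix v
  assume "\<exists>p' q'. Fract p q = Fract p' q' \<and> poly q' e \<noteq> 0 \<and> v = poly p' e / poly q' e"
  then obtain p' q' where eq: "Fract p q = Fract p' q'" and q': "poly q' e \<noteq> 0"
    and v: "v = poly p' e / poly q' e" by blast
  have "q \<noteq> 0" "q' \<noteq> 0" using assms q' by auto
  with eq have "p * q' = p' * q" by (simp add: eq_fract)
  then have "poly p e * poly q' e = poly p' e * poly q e"
    by (metis poly_mult)
  then show "v = poly p e / poly q e"
    using v assms q' by (simp add: frac_eq_eq)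
qed

lemma IntR_iff:
  "f \<in> IntR E D \<longleftrightarrow>
     (\<forall>e\<in>E. \<exists>p q. f = Fract p q \<and> poly q e \<noteq> 0 \<and> poly p e / poly q e \<in> D)"
proof -
  have "ratfun_defined_at f e \<and> ratfun_eval f e \<in> D \<longleftrightarrow>
          (\<exists>p q. f = Fract p q \<and> poly q e \<noteq> 0 \<and> poly p e / poly q e \<in> D)" for e
    unfolding ratfun_defined_at_def by (metis ratfun_eval_Fract)
  then show ?thesis by (simp add: IntR_def)
qed

lemma unital_subring_IntR:
  fixes E D :: "'k::field set"
  assumes "unital_subring D"
  shows "unital_subring (IntR E D)"
proof -
  have D1: "1 \<in> D" and Dd: "\<And>a b. a \<in> D \<Longrightarrow> b \<in> D \<Longrightarrow> a - b \<in> D"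
    and Dm: "\<And>a b. a \<in> D \<Longrightarrow> b \<in> D \<Longrightarrow> a * b \<in> D"
    using assms by (auto simp: unital_subring_def)
  have one: "1 \<in> IntR E D"
    unfolding IntR_iff
  proof
    fix e :: 'k
    have "1 = Fract 1 1 \<and> poly 1 e \<noteq> 0 \<and> poly 1 e / poly 1 e \<in> D"
      using D1 by (simp add: One_fract_def)
    then show "\<exists>p q. 1 = Fract p q \<and> poly q e \<noteq> 0 \<and> poly p e / poly q e \<in> D" by blast
  qed
  have "f - g \<in> IntR E D \<and> f * g \<in> IntR E D" if "f \<in> IntR E D" "g \<in> IntR E D" for f g
  proof -
    have "(\<exists>p q. f - g = Fract p q \<and> poly q e \<noteq> 0 \<and> poly p e / poly q e \<in> D) \<and>
          (\<exists>p q. f * g = Fract p q \<and> poly q e \<noteq> 0 \<and> poly p e / poly q e \<in> D)"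
      if e: "e \<in> E" for e
    proof -
      obtain p q where f: "f = Fract p q" and q: "poly q e \<noteq> 0" and pq: "poly p e / poly q e \<in> D"
        using \<open>f \<in> IntR E D\<close> e unfolding IntR_iff by blast
      obtain r s where g: "g = Fract r s" and s: "poly s e \<noteq> 0" and rs: "poly r e / poly s e \<in> D"
        using \<open>g \<in> IntR E D\<close> e unfolding IntR_iff by blast
      have "q \<noteq> 0" "s \<noteq> 0" using q s by auto
      then have d: "f - g = Fract (p * s - r * q) (q * s)" by (simp add: f g)
      have dv: "poly (p * s - r * q) e / poly (q * s) e = poly p e / poly q e - poly r e / poly s e"
        using q s by (simp add: field_simps)
      have m: "f * g = Fract (p * r) (q * s)" by (simp add: f g)
      have mv: "poly (p * r) e / poly (q * s) e = (poly p e / poly q e) * (poly r e / poly s e)"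
        by simp
      have nz: "poly (q * s) e \<noteq> 0" using q s by simp
      show ?thesis
        using d m nz Dd[OF pq rs, folded dv] Dm[OF pq rs, folded mv] by blast
    qed
    then show ?thesis unfolding IntR_iff by blast
  qed
  with one show ?thesis by (simp add: unital_subring_def)
qed

end

theory Submission
  imports Defs
begin

text \<open>
  Constants reduce one implication to evaluation at a point of \<open>E\<close>. If \<open>\<alpha>\<^sup>2\<close> and \<open>\<alpha>\<^sup>3\<close> lie in
  \<open>D\<close>, then, as constant functions, they lie in \<open>Int\<^sup>R(E,D)\<close>. The constant \<open>\<alpha>\<close> is a quotient of
  two constants from \<open>D\<close>, so it is in the quotient field of \<open>Int\<^sup>R(E,D)\<close> and hence in the ring
  itself (\<open>const_in_IntR_iff\<close>; this is where \<open>E\<close> has to be nonempty).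

  For the other implication, let \<open>f\<^sup>2\<close> and \<open>f\<^sup>3\<close> lie in \<open>Int\<^sup>R(E,D)\<close> and let \<open>e \<in> E\<close>. The rational
  functions defined at \<open>e\<close> form a discrete valuation ring, which is integrally closed; so \<open>f\<close> is
  defined at \<open>e\<close> because \<open>f\<^sup>2\<close> is (\<open>ratfun_defined_at_powerD\<close>). Evaluation at \<open>e\<close> commutes with
  powers, so \<open>f(e)\<^sup>2\<close> and \<open>f(e)\<^sup>3\<close> lie in \<open>D\<close>, and seminormality of \<open>D\<close> gives \<open>f(e) \<in> D\<close>.
\<close>

lemma Fract_power: "Fract p q ^ n = Fract (p ^ n) (q ^ n)"
  by (induction n) (simp_all add: One_fract_def)

text \<open>
  A representation in lowest terms locally at \<open>e\<close>. It replaces coprimality of numerator and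
  denominator: common factors are cancelled only as long as both vanish at \<open>e\<close>.
\<close>

lemma Fract_locally_reduced:
  fixes p q :: "'k::field poly"
  assumes "q \<noteq> 0"
  shows "\<exists>r s. Fract p q = Fract r s \<and> s \<noteq> 0 \<and> (poly r e \<noteq> 0 \<or> poly s e \<noteq> 0)"
  using assms
proof (induction "degree q" arbitrary: p q rule: less_induct)
  case less
  show ?case
  proof (cases "poly p e = 0 \<and> poly q e = 0")
    case True
    then obtain p' q' where p: "p = [:-e, 1:] * p'" and q: "q = [:-e, 1:] * q'"
      by (auto simp: poly_eq_0_iff_dvd elim!: dvdE)
    with less.prems have q': "q' \<noteq> 0" by auto
    then have "degree q = Suc (degree q')"
      unfolding q by (subst degree_mult_eq) auto
    moreover have "Fract p q = Fract p' q'"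
      unfolding p q by (rule mult_fract_cancel) simp
    ultimately show ?thesis
      using less.hyps[of q' p'] q' by simp
  next
    case False
    with less.prems show ?thesis by blast
  qed
qed

lemma ratfun_defined_at_powerD:
  assumes "ratfun_defined_at (f ^ n) e" and "n > 0"
  shows "ratfun_defined_at f e"
proof -
  obtain p q where f: "f = Fract p q" and q: "q \<noteq> 0"
    and red: "poly p e \<noteq> 0 \<or> poly q e \<noteq> 0"
  proof (cases f rule: Fract_cases)
    case (Fract a b)
    then show ?thesis
      using Fract_locally_reduced[of b a e] that by auto
  qed
  obtain r s where fn: "f ^ n = Fract r s" and s: "poly s e \<noteq> 0"
    using assms(1) by (auto simp: ratfun_defined_at_def)
  have "s \<noteq> 0" using s by auto
  with fn q have "p ^ n * s = r * q ^ n"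
    by (simp add: f Fract_power eq_fract)
  then have "poly p e ^ n * poly s e = poly r e * poly q e ^ n"
    by (metis poly_mult poly_power)
  \<comment> \<open>If \<open>q(e) = 0\<close>, then the right-hand side vanishes, which forces \<open>p(e) = 0\<close> as well.\<close>
  with s red \<open>n > 0\<close> have "poly q e \<noteq> 0"
    by (auto simp: power_0_left)
  then show ?thesis
    using f by (auto simp: ratfun_defined_at_def)
qed

lemma ratfun_eval_power:
  assumes "ratfun_defined_at f e"
  shows "ratfun_eval (f ^ n) e = ratfun_eval f e ^ n"
  using assms
  by (auto simp: ratfun_defined_at_def Fract_power ratfun_eval_Fract power_divide)

lemma const_in_IntR_iff:
  assumes "E \<noteq> {}"
  shows "Fract [:a:] 1 \<in> IntR E D \<longleftrightarrow> a \<in> D"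
proof -
  have "ratfun_defined_at (Fract [:a:] 1) e" for e
    unfolding ratfun_defined_at_def by (intro exI[of _ "[:a:]"] exI[of _ 1]) simp
  moreover have "ratfun_eval (Fract [:a:] 1) e = a" for e
    by (simp add: ratfun_eval_Fract)
  ultimately show ?thesis
    using assms by (auto simp: IntR_def)
qed

lemma const_in_quotient_field_IntR:
  assumes "a \<in> quotient_field D" and "E \<noteq> {}"
  shows "Fract [:a:] 1 \<in> quotient_field (IntR E D)"
proof -
  obtain b c where a: "a = b / c" and "b \<in> D" "c \<in> D" and c: "c \<noteq> 0"
    using assms(1) by (auto simp: quotient_field_def)
  then have "Fract [:b:] 1 \<in> IntR E D" "Fract [:c:] 1 \<in> IntR E D"
    using assms(2) by (simp_all add: const_in_IntR_iff)
  moreover have "Fract [:c:] 1 \<noteq> 0"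
    using c by (simp add: Zero_fract_def eq_fract)
  moreover have "Fract [:a:] 1 = Fract [:b:] 1 / Fract [:c:] 1"
    using c by (simp add: a eq_fract)
  ultimately show ?thesis
    unfolding quotient_field_def by blast
qed

theorem proposition3p3:
  fixes D E :: "'k::field set"
  assumes "unital_subring D"
    and "quotient_field D = UNIV"
    and "E \<noteq> {}"
  shows "seminormal (IntR E D) \<longleftrightarrow> seminormal D"
proof
  assume sn: "seminormal (IntR E D)"
  show "seminormal D"
    unfolding seminormal_def
  proof (intro ballI impI)
    fix a :: 'k
    assume a: "a \<in> quotient_field D" and "a ^ 2 \<in> D \<and> a ^ 3 \<in> D"
    then have "Fract [:a:] 1 ^ 2 \<in> IntR E D" "Fract [:a:] 1 ^ 3 \<in> IntR E D"
      using assms(3) by (simp_all add: Fract_power poly_const_pow const_in_IntR_iff)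
    with sn const_in_quotient_field_IntR[OF a assms(3)] have "Fract [:a:] 1 \<in> IntR E D"
      unfolding seminormal_def by blast
    then show "a \<in> D"
      using assms(3) by (simp add: const_in_IntR_iff)
  qed
next
  assume sn: "seminormal D"
  show "seminormal (IntR E D)"
    unfolding seminormal_def
  proof (intro ballI impI)
    fix f :: "'k poly fract"
    assume f: "f ^ 2 \<in> IntR E D \<and> f ^ 3 \<in> IntR E D"
    have "ratfun_defined_at f e \<and> ratfun_eval f e \<in> D" if e: "e \<in> E" for e
    proof -
      have "ratfun_defined_at (f ^ 2) e"
        using f e by (simp add: IntR_def)
      then have def_f: "ratfun_defined_at f e"
        by (rule ratfun_defined_at_powerD) simp
      have "ratfun_eval f e ^ 2 \<in> D" "ratfun_eval f e ^ 3 \<in> D"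
        using f e by (simp_all add: IntR_def flip: ratfun_eval_power[OF def_f])
      with sn assms(2) def_f show ?thesis
        unfolding seminormal_def by blast
    qed
    then show "f \<in> IntR E D"
      by (simp add: IntR_def)
  qed
qed

end
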